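(* For any two bipartite states $\rho_1$ on $A\otimes B$ and $\rho_2$ on $A'\otimes B'$ (all spaces finite-dimensional), $$E_\eta(\rho_1\otimes\rho_2)=E_\eta(\rho_1)+E_\eta(\rho_2),$$ where $\rho_1\otimes\rho_2$ is regarded as a bipartite state with respect to the bipartition $AA':BB'$.
   Context: $\log=\log_2$. A state is a positive semidefinite operator of trace one. $T_B$ denotes partial transpose on Bob's system: $(|i_Aj_B\rangle\langle k_Al_B|)^{T_B}=|i_Al_B\rangle\langle k_Aj_B|$. $\|\cdot\|_\infty$ is the operator norm. For a state $\rho$ on $A\otimes B$ with $P$ the orthogonal projection onto the support of $\rho$, $$E_\eta(\rho)=\max\{-\log\|Y^{T_B}\|_\infty:\ Y \text{ Hermitian on }A\otimes B,\ -Y\le P^{T_B}\le Y\}.$$ *)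

theory Defs
  imports "HOL-Analysis.Analysis"
begin

(* Finite-dimensional Hilbert spaces are coordinate spaces complex ^ 'n with their standard
   basis.  An operator on A \<otimes> B is a matrix over the index type 'a \<times> 'b, where M $ p $ q is the
   entry in row p and column q, i.e. the coefficient of |p><q|. *)

type_synonym 'n op = "complex ^ 'n ^ 'n"

definition cinner :: "complex ^ 'n::finite \<Rightarrow> complex ^ 'n \<Rightarrow> complex" where
  "cinner x y = (\<Sum>i\<in>UNIV. cnj (x $ i) * y $ i)"

definition adj :: "'n::finite op \<Rightarrow> 'n op" where
  "adj M = (\<chi> i j. cnj (M $ j $ i))"

definition hermitian :: "'n::finite op \<Rightarrow> bool" where
  "hermitian M \<longleftrightarrow> adj M = M"

definition psd :: "'n::finite op \<Rightarrow> bool" where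
  "psd M \<longleftrightarrow> hermitian M \<and> (\<forall>x. 0 \<le> Re (cinner x (M *v x)))"

(* The Loewner order; the library's order on vectors is componentwise. *)
definition loewner_le :: "'n::finite op \<Rightarrow> 'n op \<Rightarrow> bool" (infix "\<preceq>" 50) where
  "M \<preceq> N \<longleftrightarrow> psd (N - M)"

definition state :: "'n::finite op \<Rightarrow> bool" where
  "state \<rho> \<longleftrightarrow> psd \<rho> \<and> trace \<rho> = 1"

(* onorm is taken with respect to the Euclidean norm on complex ^ 'n. *)
definition opnorm :: "'n::finite op \<Rightarrow> real" where
  "opnorm M = onorm (\<lambda>x. M *v x)"

(* The orthogonal complement of the kernel. *)
definition support :: "'n::finite op \<Rightarrow> (complex ^ 'n) set" where
  "support M = {x. \<forall>y. M *v y = 0 \<longrightarrow> cinner y x = 0}"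

definition orth_proj_onto :: "(complex ^ 'n) set \<Rightarrow> 'n::finite op \<Rightarrow> bool" where
  "orth_proj_onto S P \<longleftrightarrow> hermitian P \<and> P ** P = P \<and> range (\<lambda>x. P *v x) = S"

definition supp_proj :: "'n::finite op \<Rightarrow> 'n op" where
  "supp_proj \<rho> = (THE P. orth_proj_onto (support \<rho>) P)"

(* Partial transpose on the second factor: |i,j><k,l| is sent to |i,l><k,j|. *)
definition ptrans :: "('a::finite \<times> 'b::finite) op \<Rightarrow> ('a \<times> 'b) op" where
  "ptrans M = (\<chi> p q. case (p, q) of ((i, j), (k, l)) \<Rightarrow> M $ (i, l) $ (k, j))"

definition eta_feasible :: "('a::finite \<times> 'b::finite) op \<Rightarrow> ('a \<times> 'b) op \<Rightarrow> bool" where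
  "eta_feasible \<rho> Y \<longleftrightarrow>
     hermitian Y \<and> - Y \<preceq> ptrans (supp_proj \<rho>) \<and> ptrans (supp_proj \<rho>) \<preceq> Y"

(* GREATEST denotes an attained maximum and is unspecified if there is none. *)
definition E_eta :: "('a::finite \<times> 'b::finite) op \<Rightarrow> real" where
  "E_eta \<rho> = (GREATEST e. \<exists>Y. eta_feasible \<rho> Y \<and> e = - log 2 (opnorm (ptrans Y)))"

(* The tensor product of operators on A \<otimes> B and A' \<otimes> B', with the factors regrouped
   as (A \<otimes> A') \<otimes> (B \<otimes> B'). *)
definition bitensor ::
  "('a::finite \<times> 'b::finite) op \<Rightarrow> ('c::finite \<times> 'd::finite) op \<Rightarrow> (('a \<times> 'c) \<times> ('b \<times> 'd)) op" where
  "bitensor M N = (\<chi> p q. case (p, q) of (((i, i'), (j, j')), ((k, k'), (l, l'))) \<Rightarrow>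
     M $ (i, j) $ (k, l) * N $ (i', j') $ (k', l'))"

end

theory Submission
  imports Defs
begin

text \<open>
  By compactness \<open>E_eta \<rho> = - log 2 r\<close>, where \<open>r\<close> is the least value of the operator norm of
  \<open>ptrans Y\<close> over the \<open>Y\<close> dominating \<open>\<plusminus> ptrans P\<close>, so \<open>r\<close> has to be shown multiplicative.  For
  \<open>r \<le> r\<^sub>1 r\<^sub>2\<close> take \<open>Y\<^sub>1 \<otimes> Y\<^sub>2\<close>: twice \<open>Y\<^sub>1 \<otimes> Y\<^sub>2 \<minusplus> Q\<^sub>1 \<otimes> Q\<^sub>2\<close> is a sum of tensor products of
  the positive operators \<open>Y\<^sub>i \<plusminus> Q\<^sub>i\<close>.  For \<open>r \<ge> r\<^sub>1 r\<^sub>2\<close> a dual witness is needed for the second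
  factor only: a Hermitian \<open>Z\<close> in the dual unit ball with \<open>Z \<bullet> ptrans Y\<^sub>2 \<ge> r\<^sub>2\<close> for all feasible
  \<open>Y\<^sub>2\<close>.  Contracting a \<open>Y\<close> that is feasible for the product with \<open>ptrans Z\<close> and dividing by \<open>r\<^sub>2\<close>
  yields an operator feasible for the first factor, and since \<open>Z\<close> lies in the dual unit ball,
  the contraction does not increase the operator norm of the partial transpose.
\<close>

subsection \<open>Hermitian operators and the operator norm\<close>

text \<open>The bridge to real Euclidean geometry: with the real inner product, Cauchy-Schwarz,
  orthogonal decomposition and hyperplane separation apply directly.\<close>

lemma Re_cinner: "Re (cinner x y) = x \<bullet> y"
  by (simp add: cinner_def inner_vec_def inner_complex_def)

lemma cinner_adj: "cinner x (M *v y) = cinner (adj M *v x) y"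
proof -
  have "cinner x (M *v y) = (\<Sum>i\<in>UNIV. \<Sum>j\<in>UNIV. cnj (x $ i) * (M $ i $ j * y $ j))"
    by (simp add: cinner_def matrix_vector_mult_def sum_distrib_left)
  also have "\<dots> = (\<Sum>j\<in>UNIV. \<Sum>i\<in>UNIV. cnj (x $ i) * (M $ i $ j * y $ j))"
    by (rule sum.swap)
  also have "\<dots> = cinner (adj M *v x) y"
    by (simp add: cinner_def matrix_vector_mult_def sum_distrib_left sum_distrib_right adj_def mult_ac)
  finally show ?thesis .
qed

lemma inner_adj: "x \<bullet> (M *v y) = (adj M *v x) \<bullet> y"
  using cinner_adj[of x M y] by (metis Re_cinner)

lemma matrix_vector_mult_axis: "(M *v axis j b) $ i = M $ i $ j * (b::complex)"
  by (simp add: matrix_vector_mult_def axis_def if_distrib [of "(*) _"] cong: if_cong)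

lemma hermitian_nth: "hermitian M \<longleftrightarrow> (\<forall>i j. M $ j $ i = cnj (M $ i $ j))"
  unfolding hermitian_def adj_def vec_eq_iff vec_lambda_beta by (blast intro: sym)

text \<open>Symmetry for the real inner product suffices: since M is complex linear, testing also
  with \<open>\<i>\<close> times a basis vector recovers the imaginary parts of the entries.\<close>

lemma hermitian_iff: "hermitian M \<longleftrightarrow> (\<forall>x y. x \<bullet> (M *v y) = (M *v x) \<bullet> y)"
proof
  assume "hermitian M"
  then show "\<forall>x y. x \<bullet> (M *v y) = (M *v x) \<bullet> y"
    by (simp add: inner_adj hermitian_def)
next
  assume *: "\<forall>x y. x \<bullet> (M *v y) = (M *v x) \<bullet> y"
  show "hermitian M"
    unfolding hermitian_nth
  proof (intro allI complex_eqI)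
    fix i j
    show "Re (M $ j $ i) = Re (cnj (M $ i $ j))"
      using *[rule_format, of "axis i 1" "axis j 1"]
      by (simp add: inner_axis inner_axis' matrix_vector_mult_axis inner_complex_def)
    show "Im (M $ j $ i) = Im (cnj (M $ i $ j))"
      using *[rule_format, of "axis i \<i>" "axis j 1"]
      by (simp add: inner_axis inner_axis' matrix_vector_mult_axis inner_complex_def)
  qed
qed

lemma psd_iff: "psd M \<longleftrightarrow> hermitian M \<and> (\<forall>x. 0 \<le> x \<bullet> (M *v x))"
  by (simp add: psd_def Re_cinner)

lemma scaleR_matrix_vector_mult: "(c *\<^sub>R M) *v x = c *\<^sub>R (M *v (x :: complex ^ 'n))"
  by (simp add: matrix_vector_mult_def vec_eq_iff scaleR_sum_right)

lemma matrix_vector_mult_scaleR': "M *v (c *\<^sub>R x) = c *\<^sub>R (M *v (x :: complex ^ 'n))"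
  by (simp add: matrix_vector_mult_def vec_eq_iff scaleR_sum_right)

lemma uminus_matrix_vector_mult: "(- M) *v x = - (M *v (x :: complex ^ 'n))"
  by (simp add: matrix_vector_mult_def vec_eq_iff sum_negf)

lemma hermitian_add: "hermitian M \<Longrightarrow> hermitian N \<Longrightarrow> hermitian (M + N)"
  and hermitian_diff: "hermitian M \<Longrightarrow> hermitian N \<Longrightarrow> hermitian (M - N)"
  and hermitian_scaleR: "hermitian M \<Longrightarrow> hermitian (c *\<^sub>R M)"
  and hermitian_uminus: "hermitian M \<Longrightarrow> hermitian (- M)"
  by (simp_all add: hermitian_def adj_def vec_eq_iff)

lemma loewner_le_iff:
  assumes "hermitian M" "hermitian N"
  shows "M \<preceq> N \<longleftrightarrow> (\<forall>x. x \<bullet> (M *v x) \<le> x \<bullet> (N *v x))"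
  using assms
  by (simp add: loewner_le_def psd_iff hermitian_diff matrix_vector_mult_diff_rdistrib inner_diff_right)

lemma norm_mult_le_opnorm: "norm (M *v x) \<le> opnorm M * norm x"
  unfolding opnorm_def by (rule onorm) (simp add: linear_linear)

lemma inner_mult_le_opnorm: "u \<bullet> (M *v v) \<le> opnorm M * (norm u * norm v)"
proof -
  have "u \<bullet> (M *v v) \<le> norm u * norm (M *v v)" by (rule norm_cauchy_schwarz)
  also have "\<dots> \<le> norm u * (opnorm M * norm v)"
    by (intro mult_left_mono norm_mult_le_opnorm) simp
  finally show ?thesis by (simp add: mult_ac)
qed

lemma opnorm_nonneg: "0 \<le> opnorm M"
  unfolding opnorm_def by (rule onorm_pos_le) (simp add: linear_linear)

text \<open>Taking u = M x in the bilinear bound gives norm (M x)^2 \<le> K norm x norm (M x), and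
  one factor cancels.\<close>

lemma opnorm_leI:
  assumes "0 \<le> K" "\<And>u v. u \<bullet> (M *v v) \<le> K * (norm u * norm v)"
  shows "opnorm M \<le> K"
  unfolding opnorm_def
proof (rule onorm_bound[OF assms(1)])
  fix x
  have "norm (M *v x) * norm (M *v x) \<le> (K * norm x) * norm (M *v x)"
    using assms(2)[of "M *v x" x]
    by (simp add: power2_norm_eq_inner[symmetric] power2_eq_square mult_ac)
  then show "norm (M *v x) \<le> K * norm x"
    by (cases "M *v x = 0") (simp_all add: assms)
qed

lemma opnorm_add: "opnorm (M + N) \<le> opnorm M + opnorm N"
proof (rule opnorm_leI)
  show "u \<bullet> ((M + N) *v v) \<le> (opnorm M + opnorm N) * (norm u * norm v)" for u v
    using inner_mult_le_opnorm[of u M v] inner_mult_le_opnorm[of u N v]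
    by (simp add: matrix_vector_mult_add_rdistrib inner_add_right distrib_right)
qed (simp add: opnorm_nonneg)

lemma opnorm_scaleR: "opnorm (c *\<^sub>R M) = \<bar>c\<bar> * opnorm M"
  unfolding opnorm_def scaleR_matrix_vector_mult
  by (rule onorm_scaleR) (simp add: linear_linear)

lemma opnorm_adj: "opnorm (adj M) \<le> opnorm M"
proof (rule opnorm_leI[OF opnorm_nonneg])
  fix u v
  have "u \<bullet> (adj M *v v) = v \<bullet> (M *v u)"
    by (metis inner_adj inner_commute)
  then show "u \<bullet> (adj M *v v) \<le> opnorm M * (norm u * norm v)"
    using inner_mult_le_opnorm[of v M u] by (simp add: mult_ac)
qed

section \<open>Comparison of the operator norm with the Euclidean norm, and its continuity\<close>

lemma nth_le_opnorm: "norm (M $ i $ j) \<le> opnorm M"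
proof -
  have "norm (M $ i $ j) = norm ((M *v axis j 1) $ i)"
    by (simp add: matrix_vector_mult_axis)
  also have "\<dots> \<le> norm (M *v axis j 1)" by (rule Finite_Cartesian_Product.norm_nth_le)
  also have "\<dots> \<le> opnorm M" using norm_mult_le_opnorm[of M "axis j 1"] by simp
  finally show ?thesis .
qed

lemma norm_vec_le_sum: "norm x \<le> (\<Sum>i\<in>UNIV. norm (x $ i))"
  by (simp add: norm_vec_def L2_set_le_sum)

text \<open>A crude equivalence of norms: it gives definiteness of \<open>opnorm\<close> and turns
  operator-norm bounds into bounded sets for the compactness argument.\<close>

lemma norm_le_opnorm:
  fixes M :: "'n::finite op"
  shows "norm M \<le> real CARD('n) * (real CARD('n) * opnorm M)"
proof -
  have "norm M \<le> (\<Sum>i\<in>UNIV. \<Sum>j\<in>UNIV. norm (M $ i $ j))"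
    by (rule order_trans[OF norm_vec_le_sum])
      (intro sum_mono norm_vec_le_sum)
  also have "\<dots> \<le> (\<Sum>i\<in>(UNIV :: 'n set). \<Sum>j\<in>(UNIV :: 'n set). opnorm M)"
    by (intro sum_mono nth_le_opnorm)
  finally show ?thesis by simp
qed

lemma opnorm_eq_0: "opnorm M = 0 \<Longrightarrow> M = 0"
  using norm_le_opnorm[of M] by simp

lemma convex_on_opnorm: "convex_on UNIV opnorm"
proof (rule convex_onI)
  fix t :: real and M N :: "'a op"
  assume "0 < t" "t < 1"
  then show "opnorm ((1 - t) *\<^sub>R M + t *\<^sub>R N) \<le> (1 - t) * opnorm M + t * opnorm N"
    using opnorm_add[of "(1 - t) *\<^sub>R M" "t *\<^sub>R N"] by (simp add: opnorm_scaleR)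
qed simp

text \<open>A convex function on an open set in finite dimension is continuous.\<close>

lemma continuous_on_opnorm: "continuous_on S opnorm"
  by (rule continuous_on_subset[OF convex_on_continuous[OF open_UNIV convex_on_opnorm]]) simp

subsection \<open>Support projections\<close>

text \<open>Each projection fixes the range of the other, so PQ = Q and QP = P. Taking adjoints in
  the second identity gives PQ = P.\<close>

lemma orth_proj_onto_unique:
  assumes "orth_proj_onto S P" "orth_proj_onto S Q"
  shows "P = Q"
proof -
  have PQ: "P *v (Q *v x) = Q *v x" and QP: "Q *v (P *v x) = P *v x" for x
  proof -
    have "Q *v x \<in> range (\<lambda>x. P *v x)" "P *v x \<in> range (\<lambda>x. Q *v x)"
      using assms unfolding orth_proj_onto_def by blast+
    then show "P *v (Q *v x) = Q *v x" "Q *v (P *v x) = P *v x"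
      using assms unfolding orth_proj_onto_def by (metis imageE matrix_vector_mul_assoc)+
  qed
  have "P *v x = Q *v x" for x
  proof -
    have "y \<bullet> (P *v x) = y \<bullet> (Q *v x)" for y
    proof -
      have "y \<bullet> (P *v x) = (P *v (Q *v y)) \<bullet> x"
        using assms QP[of x] by (metis hermitian_iff orth_proj_onto_def)
      also have "\<dots> = y \<bullet> (Q *v x)"
        using assms PQ[of y] by (metis hermitian_iff orth_proj_onto_def)
      finally show ?thesis .
    qed
    then have "\<forall>y. y \<bullet> (P *v x) = y \<bullet> (Q *v x)" by (rule allI)
    then show ?thesis by (rule vector_eq_ldot[THEN iffD1])
  qed
  then show ?thesis unfolding matrix_eq by (rule allI)
qed

lemma inner_scale_left: "(c *s x) \<bullet> y = x \<bullet> (cnj c *s (y :: complex ^ 'n))"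
  by (simp add: inner_vec_def inner_complex_def algebra_simps)

text \<open>The kernel is closed under multiplication by \<open>\<i>\<close>, and the real inner
  product of \<open>\<i>\<close>y with x is the imaginary part of \<open>cinner y x\<close>. Hence
  real orthogonality to the kernel is complex orthogonality.\<close>

lemma matrix_vector_mult_eq_0_iff_cinner:
  "(\<forall>y. M *v y = 0 \<longrightarrow> cinner y x = 0) \<longleftrightarrow> (\<forall>y. M *v y = 0 \<longrightarrow> y \<bullet> x = 0)"
proof (intro iffI allI impI)
  fix y assume *: "\<forall>y. M *v y = 0 \<longrightarrow> y \<bullet> x = 0" and y: "M *v y = 0"
  have "M *v (\<i> *s y) = 0" using y by (simp add: matrix_vector_mult_def vec_eq_iff sum_distrib_left[symmetric] mult.left_commute)
  then have "(\<i> *s y) \<bullet> x = 0" "y \<bullet> x = 0" using * y by auto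
  moreover have "(\<i> *s y) \<bullet> x = Im (cinner y x)"
    by (simp add: cinner_def inner_vec_def inner_complex_def algebra_simps)
  ultimately show "cinner y x = 0"
    by (simp add: complex_eq_iff Re_cinner)
qed (metis Re_cinner zero_complex.sel(1))

text \<open>Identifies a support projection by its kernel alone, which is convenient for tensor
  products because their kernels can be compared one factor at a time.\<close>

lemma supp_proj_eqI:
  assumes h: "hermitian P" and i: "P ** P = P" and k: "\<And>x. P *v x = 0 \<longleftrightarrow> M *v x = 0"
  shows "supp_proj M = P"
proof -
  have PP: "P *v (P *v x) = P *v x" for x
    using i by (simp add: matrix_vector_mul_assoc)
  have "P *v x \<in> support M" for x
    using h k unfolding support_def mem_Collect_eq matrix_vector_mult_eq_0_iff_cinner hermitian_iff
    by (metis inner_zero_left)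
  moreover have "x \<in> range (\<lambda>x. P *v x)" if "x \<in> support M" for x
  proof -
    \<comment> \<open>The residual x - Px lies in the common kernel, so it is orthogonal to x in the
      support, and also to Px. Thus it is orthogonal to itself.\<close>
    have "P *v (x - P *v x) = 0" by (simp add: PP matrix_vector_mult_diff_distrib)
    moreover from this have "(x - P *v x) \<bullet> x = 0"
      using that k unfolding support_def mem_Collect_eq matrix_vector_mult_eq_0_iff_cinner by blast
    moreover have "(x - P *v x) \<bullet> (P *v x) = (P *v (x - P *v x)) \<bullet> x"
      using h unfolding hermitian_iff by blast
    ultimately have "(x - P *v x) \<bullet> (x - P *v x) = 0"
      by (simp only: inner_diff_right[of "x - P *v x" x]) simp
    then have "x = P *v x" by simp
    then show ?thesis by blast
  qed
  ultimately have "orth_proj_onto (support M) P"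
    using h i by (auto simp: orth_proj_onto_def)
  then show ?thesis
    unfolding supp_proj_def using orth_proj_onto_unique by blast
qed

lemma supp_proj:
  fixes M :: "'n::finite op"
  shows hermitian_supp_proj: "hermitian (supp_proj M)"
    and idem_supp_proj: "supp_proj M ** supp_proj M = supp_proj M"
    and supp_proj_eq_0_iff: "supp_proj M *v x = 0 \<longleftrightarrow> M *v x = 0"
proof -
  define S where "S = {x. M *v x = 0}"
  \<comment> \<open>\<open>R x z\<close> says that z is the component of x orthogonal to the kernel
    of M. Its uniqueness makes the map from x to z complex linear.\<close>
  define R where "R x z \<longleftrightarrow> M *v (x - z) = 0 \<and> (\<forall>w. M *v w = 0 \<longrightarrow> z \<bullet> w = 0)" for x z
  have Msc: "M *v (c *s x) = c *s (M *v x)" for c x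
    by (simp add: matrix_vector_mult_def vec_eq_iff sum_distrib_left mult_ac)
  have sub: "subspace S"
    by (auto simp: S_def subspace_def matrix_vector_right_distrib matrix_vector_mult_scaleR')
  have ex: "\<exists>z. R x z" for x
  proof -
    obtain y z where "y \<in> span S" "\<And>w. w \<in> span S \<Longrightarrow> orthogonal z w" "x = y + z"
      using orthogonal_subspace_decomp_exists[of S x] by metis
    then have "R x z"
      using sub by (auto simp: R_def span_eq_iff[THEN iffD2] S_def orthogonal_def)
    then show ?thesis ..
  qed
  have uniq: "z = z'" if "R x z" "R x z'" for x z z'
  proof -
    have "z - z' = (x - z') - (x - z)" by simp
    then have "M *v (z - z') = 0"
      using that by (simp only: matrix_vector_mult_diff_distrib[of M "x - z'"] R_def) simp
    then have "z \<bullet> (z - z') = 0" "z' \<bullet> (z - z') = 0"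
      using that unfolding R_def by blast+
    then have "(z - z') \<bullet> (z - z') = 0"
      by (simp only: inner_diff_left[of z z'] diff_self)
    then show ?thesis by simp
  qed
  define f where "f x = (SOME z. R x z)" for x
  have f: "R x (f x)" for x
    unfolding f_def using ex by (rule someI_ex)
  have fR: "f x = z" if "R x z" for x z using uniq[OF f that] .
  have add: "f (x + y) = f x + f y" for x y
  proof (rule fR)
    have "x + y - (f x + f y) = (x - f x) + (y - f y)" by simp
    then show "R (x + y) (f x + f y)"
      using f[of x] f[of y] unfolding R_def by (simp only: matrix_vector_right_distrib inner_add_left) simp
  qed
  have scl: "f (c *s x) = c *s f x" for c x
  proof (rule fR)
    \<comment> \<open>Orthogonality survives the complex scalar because c moves to the other
      argument as its conjugate, and the kernel is a complex subspace.\<close>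
    have "c *s x - c *s f x = c *s (x - f x)" by (simp add: vector_ssub_ldistrib)
    then show "R (c *s x) (c *s f x)"
      using f[of x] unfolding R_def by (simp only: Msc inner_scale_left) (simp add: Msc)
  qed
  define P where "P = matrix f"
  have P: "P *v x = f x" for x
    unfolding P_def
    by (rule matrix_works, unfold_locales) (simp_all add: add scl vector_add_ldistrib vector_sadd_rdistrib algebra_simps)
  have sa: "f x \<bullet> y = f x \<bullet> f y" for x y
  proof -
    have "f x \<bullet> (y - f y) = 0" using f[of x] f[of y] by (auto simp: R_def)
    then show ?thesis by (simp add: inner_diff_right)
  qed
  have h: "hermitian P"
    unfolding hermitian_iff P by (metis sa inner_commute)
  have "f (f x) = f x" for x using f[of x] by (intro fR) (auto simp: R_def)
  then have i: "P ** P = P"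
    by (simp add: matrix_eq matrix_vector_mul_assoc[symmetric] P)
  have k: "P *v x = 0 \<longleftrightarrow> M *v x = 0" for x
    unfolding P using f[of x] fR[of x 0] by (auto simp: R_def)
  have e: "supp_proj M = P" by (rule supp_proj_eqI[OF h i k])
  show "hermitian (supp_proj M)" "supp_proj M ** supp_proj M = supp_proj M"
    "supp_proj M *v x = 0 \<longleftrightarrow> M *v x = 0"
    using h i k e by simp_all
qed

subsection \<open>Regrouped tensor products\<close>

text \<open>Joins an index of A \<otimes> B and one of A' \<otimes> B' into an index for the cut
  AA':BB'. In these coordinates \<open>bitensor\<close> is an ordinary tensor product.\<close>

definition idx :: "'a \<times> 'b \<Rightarrow> 'c \<times> 'd \<Rightarrow> ('a \<times> 'c) \<times> ('b \<times> 'd)" where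
  "idx p p' = ((fst p, fst p'), (snd p, snd p'))"

lemma idx_exhaust: obtains p p' where "r = idx p p'"
proof
  show "r = idx (fst (fst r), fst (snd r)) (snd (fst r), snd (snd r))"
    by (simp add: idx_def)
qed

lemma vec_eq_idx_iff: "x = y \<longleftrightarrow> (\<forall>p p'. x $ idx p p' = y $ idx p p')"
  unfolding vec_eq_iff by (metis idx_exhaust)

lemma sum_idx:
  fixes f :: "('a::finite \<times> 'c::finite) \<times> ('b::finite \<times> 'd::finite) \<Rightarrow> 'e::comm_monoid_add"
  shows "(\<Sum>r\<in>UNIV. f r) = (\<Sum>p\<in>UNIV. \<Sum>p'\<in>UNIV. f (idx p p'))"
proof -
  have "(\<Sum>p\<in>UNIV. \<Sum>p'\<in>UNIV. f (idx p p')) = (\<Sum>(p, p')\<in>UNIV \<times> UNIV. f (idx p p'))"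
    by (simp add: sum.cartesian_product)
  also have "\<dots> = (\<Sum>r\<in>UNIV. f r)"
    by (rule sum.reindex_bij_witness[where j = "\<lambda>(p, p'). idx p p'" and
          i = "\<lambda>r. ((fst (fst r), fst (snd r)), (snd (fst r), snd (snd r)))"])
      (auto simp: idx_def)
  finally show ?thesis by simp
qed

lemma bitensor_idx: "bitensor M N $ idx p p' $ idx q q' = M $ p $ q * N $ p' $ q'"
  by (simp add: bitensor_def idx_def)

lemma bitensor_add_left: "bitensor (M + M') N = bitensor M N + bitensor M' N"
  and bitensor_add_right: "bitensor M (N + N') = bitensor M N + bitensor M N'"
  and bitensor_diff_left: "bitensor (M - M') N = bitensor M N - bitensor M' N"
  and bitensor_diff_right: "bitensor M (N - N') = bitensor M N - bitensor M N'"
  and bitensor_scaleR_left: "bitensor (c *\<^sub>R M) N = c *\<^sub>R bitensor M N"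
  by (simp_all add: vec_eq_idx_iff bitensor_idx algebra_simps)

lemma hermitian_bitensor: "hermitian M \<Longrightarrow> hermitian N \<Longrightarrow> hermitian (bitensor M N)"
  by (simp add: hermitian_def adj_def vec_eq_idx_iff bitensor_idx) (simp add: vec_eq_iff)

text \<open>The product vector u \<otimes> x in regrouped coordinates.\<close>

definition tvec :: "complex ^ ('a \<times> 'b) \<Rightarrow> complex ^ ('c \<times> 'd)
    \<Rightarrow> complex ^ (('a::finite \<times> 'c::finite) \<times> ('b::finite \<times> 'd::finite))" where
  "tvec u x = (\<chi> r. u $ (fst (fst r), fst (snd r)) * x $ (snd (fst r), snd (snd r)))"

lemma tvec_idx: "tvec u x $ idx p p' = u $ p * x $ p'"
  by (simp add: tvec_def idx_def)

lemma cinner_tvec: "cinner (tvec u x) (tvec v y) = cinner u v * cinner x y"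
  by (simp add: cinner_def sum_idx tvec_idx sum_product mult_ac)

lemma Im_cinner_self: "Im (cinner x x) = 0"
  by (simp add: cinner_def)

lemma norm_tvec: "norm (tvec u x) = norm u * norm x"
proof -
  have "(norm (tvec u x))\<^sup>2 = (norm u * norm x)\<^sup>2"
    by (simp add: power_mult_distrib power2_norm_eq_inner Re_cinner[symmetric] cinner_tvec Im_cinner_self)
  then show ?thesis by (simp add: power2_eq_iff_nonneg)
qed

lemma bitensor_tvec: "bitensor M N *v tvec u x = tvec (M *v u) (N *v x)"
  by (simp add: vec_eq_idx_iff matrix_vector_mult_def sum_idx bitensor_idx tvec_idx sum_product mult_ac)

lemma Im_cinner_hermitian:
  assumes "hermitian M" shows "Im (cinner x (M *v x)) = 0"
proof -
  have "cnj (cinner x (M *v x)) = cinner (M *v x) x"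
    by (simp add: cinner_def mult.commute)
  also have "\<dots> = cinner x (M *v x)"
    using assms by (simp add: cinner_adj hermitian_def)
  finally show ?thesis by (simp add: complex_eq_iff)
qed

text \<open>Real parts multiply here because the first factor, the form of a Hermitian operator, is
  real.\<close>

lemma inner_bitensor_tvec:
  assumes "hermitian M"
  shows "tvec u x \<bullet> (bitensor M N *v tvec u x) = (u \<bullet> (M *v u)) * (x \<bullet> (N *v x))"
  by (simp add: Re_cinner[symmetric] bitensor_tvec cinner_tvec Im_cinner_hermitian[OF assms])

text \<open>The actions of \<open>M \<otimes> 1\<close> and \<open>1 \<otimes> N\<close>.\<close>

definition actL :: "('a \<times> 'b) op \<Rightarrow> complex ^ (('a::finite \<times> 'c::finite) \<times> ('b::finite \<times> 'd::finite))
    \<Rightarrow> complex ^ (('a \<times> 'c) \<times> ('b \<times> 'd))" where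
  "actL M y = (\<chi> r. (M *v (\<chi> q. y $ idx q (snd (fst r), snd (snd r)))) $ (fst (fst r), fst (snd r)))"

definition actR :: "('c \<times> 'd) op \<Rightarrow> complex ^ (('a::finite \<times> 'c::finite) \<times> ('b::finite \<times> 'd::finite))
    \<Rightarrow> complex ^ (('a \<times> 'c) \<times> ('b \<times> 'd))" where
  "actR N y = (\<chi> r. (N *v (\<chi> q'. y $ idx (fst (fst r), fst (snd r)) q')) $ (snd (fst r), snd (snd r)))"

lemma actL_idx: "actL M y $ idx p p' = (M *v (\<chi> q. y $ idx q p')) $ p"
  by (simp add: actL_def idx_def)

lemma actR_idx: "actR N y $ idx p p' = (N *v (\<chi> q'. y $ idx p q')) $ p'"
  by (simp add: actR_def idx_def)

lemma bitensor_eq_actL: "bitensor M N *v y = actL M (actR N y)"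
  by (simp add: vec_eq_idx_iff actL_idx actR_idx matrix_vector_mult_def sum_idx bitensor_idx
      sum_distrib_left mult_ac)

lemma bitensor_eq_actR: "bitensor M N *v y = actR N (actL M y)"
  by (simp add: vec_eq_idx_iff actL_idx actR_idx matrix_vector_mult_def sum_idx bitensor_idx
      sum_distrib_left mult_ac) (subst sum.swap, simp)

lemma norm_sq_vec: "(norm (x :: complex ^ 'n))\<^sup>2 = (\<Sum>i\<in>UNIV. (norm (x $ i))\<^sup>2)"
  by (simp add: norm_vec_def L2_set_def sum_nonneg)

text \<open>M acts separately on each slice of y with fixed second index; the squared norms of the
  slices add up.\<close>

lemma norm_actL: "norm (actL M y) \<le> opnorm M * norm y"
proof (rule power2_le_imp_le)
  have "(norm (actL M y))\<^sup>2 = (\<Sum>p'\<in>UNIV. \<Sum>p\<in>UNIV. (norm (actL M y $ idx p p'))\<^sup>2)"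
    by (subst sum.swap) (simp add: norm_sq_vec sum_idx)
  also have "\<dots> = (\<Sum>p'\<in>UNIV. (norm (M *v (\<chi> q. y $ idx q p')))\<^sup>2)"
    by (simp add: norm_sq_vec actL_idx)
  also have "\<dots> \<le> (\<Sum>p'\<in>UNIV. (opnorm M * norm (\<chi> q. y $ idx q p'))\<^sup>2)"
    by (intro sum_mono power_mono norm_mult_le_opnorm) simp
  also have "\<dots> = (opnorm M * norm y)\<^sup>2"
    by (simp add: power_mult_distrib norm_sq_vec sum_idx sum_distrib_left[symmetric])
      (subst sum.swap, simp)
  finally show "(norm (actL M y))\<^sup>2 \<le> (opnorm M * norm y)\<^sup>2" .
qed (simp add: opnorm_nonneg)

lemma norm_actR: "norm (actR N y) \<le> opnorm N * norm y"
proof (rule power2_le_imp_le)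
  have "(norm (actR N y))\<^sup>2 = (\<Sum>p\<in>UNIV. (norm (N *v (\<chi> q'. y $ idx p q')))\<^sup>2)"
    by (simp add: norm_sq_vec sum_idx actR_idx)
  also have "\<dots> \<le> (\<Sum>p\<in>UNIV. (opnorm N * norm (\<chi> q'. y $ idx p q'))\<^sup>2)"
    by (intro sum_mono power_mono norm_mult_le_opnorm) simp
  also have "\<dots> = (opnorm N * norm y)\<^sup>2"
    by (simp add: power_mult_distrib norm_sq_vec sum_idx sum_distrib_left[symmetric])
  finally show "(norm (actR N y))\<^sup>2 \<le> (opnorm N * norm y)\<^sup>2" .
qed (simp add: opnorm_nonneg)

lemma opnorm_bitensor_le: "opnorm (bitensor M N) \<le> opnorm M * opnorm N"
  unfolding opnorm_def[of "bitensor M N"]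
proof (rule onorm_bound)
  fix y
  have "norm (bitensor M N *v y) \<le> opnorm M * norm (actR N y)"
    unfolding bitensor_eq_actL by (rule norm_actL)
  also have "\<dots> \<le> opnorm M * (opnorm N * norm y)"
    by (intro mult_left_mono norm_actR opnorm_nonneg)
  finally show "norm (bitensor M N *v y) \<le> opnorm M * opnorm N * norm y"
    by (simp add: mult.assoc)
qed (simp add: opnorm_nonneg)

lemma actL_eq_0_iff: "actL M y = 0 \<longleftrightarrow> (\<forall>p'. M *v (\<chi> q. y $ idx q p') = 0)"
  by (auto simp: vec_eq_idx_iff actL_idx) (simp_all add: vec_eq_iff)

lemma actR_eq_0_iff: "actR N y = 0 \<longleftrightarrow> (\<forall>p. N *v (\<chi> q'. y $ idx p q') = 0)"
  by (auto simp: vec_eq_idx_iff actR_idx) (simp_all add: vec_eq_iff)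

lemma supp_proj_bitensor:
  "supp_proj (bitensor M N) = bitensor (supp_proj M) (supp_proj N)"
proof (rule supp_proj_eqI)
  show "hermitian (bitensor (supp_proj M) (supp_proj N))"
    by (intro hermitian_bitensor hermitian_supp_proj)
  have actLL: "actL A (actL B y) = actL (A ** B) y"
    and actRR: "actR C (actR D y) = actR (C ** D) y" for A B C D y
    by (simp_all add: vec_eq_idx_iff actL_idx actR_idx matrix_vector_mul_assoc[symmetric])
  let ?P = "bitensor (supp_proj M) (supp_proj N)"
  have "?P *v (?P *v y) = ?P *v y" for y
  proof -
    have "?P *v (?P *v y) = actL (supp_proj M) (actR (supp_proj N) (actR (supp_proj N) (actL (supp_proj M) y)))"
      by (metis bitensor_eq_actL bitensor_eq_actR)
    also have "\<dots> = actL (supp_proj M) (actL (supp_proj M) (actR (supp_proj N) y))"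
      by (metis bitensor_eq_actL bitensor_eq_actR actRR idem_supp_proj)
    also have "\<dots> = ?P *v y"
      by (metis bitensor_eq_actL actLL idem_supp_proj)
    finally show ?thesis .
  qed
  then show "?P ** ?P = ?P"
    by (simp add: matrix_eq matrix_vector_mul_assoc[symmetric])
  show "?P *v y = 0 \<longleftrightarrow> bitensor M N *v y = 0" for y
  proof -
    \<comment> \<open>A factor and its support projection have the same kernel. Since the two
      actions commute, each factor can be brought outermost and exchanged in turn.\<close>
    have "?P *v y = 0 \<longleftrightarrow> actL M (actR (supp_proj N) y) = 0"
      by (simp add: bitensor_eq_actL actL_eq_0_iff supp_proj_eq_0_iff)
    also have "\<dots> \<longleftrightarrow> actR (supp_proj N) (actL M y) = 0"
      by (metis bitensor_eq_actL bitensor_eq_actR)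
    also have "\<dots> \<longleftrightarrow> bitensor M N *v y = 0"
      by (simp add: bitensor_eq_actR actR_eq_0_iff supp_proj_eq_0_iff)
    finally show ?thesis .
  qed
qed

subsection \<open>Partial transposition and partial contraction\<close>

lemma ptrans_nth: "ptrans M $ p $ q = M $ (fst p, snd q) $ (fst q, snd p)"
  by (cases p; cases q) (simp add: ptrans_def)

lemma ptrans_ptrans [simp]: "ptrans (ptrans M) = M"
  by (simp add: vec_eq_iff ptrans_nth)

lemma ptrans_linear: "linear ptrans"
  by (rule linearI) (simp_all add: vec_eq_iff ptrans_nth)

lemma hermitian_ptrans: "hermitian M \<Longrightarrow> hermitian (ptrans M)"
  by (simp add: hermitian_def adj_def vec_eq_iff ptrans_nth)

lemma ptrans_bitensor: "ptrans (bitensor M N) = bitensor (ptrans M) (ptrans N)"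
  by (simp add: vec_eq_iff ptrans_nth bitensor_def)

lemma sum_ptrans:
  fixes f :: "'a::finite \<times> 'b::finite \<Rightarrow> 'a \<times> 'b \<Rightarrow> 'e::comm_monoid_add"
  shows "(\<Sum>p\<in>UNIV. \<Sum>q\<in>UNIV. f (fst p, snd q) (fst q, snd p)) = (\<Sum>p\<in>UNIV. \<Sum>q\<in>UNIV. f p q)"
proof -
  have "(\<Sum>(p, q)\<in>UNIV \<times> UNIV. f (fst p, snd q) (fst q, snd p)) = (\<Sum>(p, q)\<in>UNIV \<times> UNIV. f p q)"
    by (rule sum.reindex_bij_witness[where j = "\<lambda>(p, q). ((fst p, snd q), (fst q, snd p))" and
          i = "\<lambda>(p, q). ((fst p, snd q), (fst q, snd p))"]) auto
  then show ?thesis by (simp add: sum.cartesian_product)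
qed

lemma inner_mat: "Z \<bullet> X = Re (\<Sum>i\<in>UNIV. \<Sum>j\<in>UNIV. cnj (Z $ i $ j) * X $ i $ j)"
  by (simp add: inner_vec_def inner_complex_def)

lemma inner_ptrans: "ptrans Z \<bullet> X = Z \<bullet> ptrans X"
proof -
  have "(\<Sum>p\<in>UNIV. \<Sum>q\<in>UNIV. cnj (ptrans Z $ p $ q) * X $ p $ q)
      = (\<Sum>p\<in>UNIV. \<Sum>q\<in>UNIV. cnj (Z $ p $ q) * ptrans X $ p $ q)"
    using sum_ptrans[of "\<lambda>p q. cnj (Z $ p $ q) * ptrans X $ p $ q"] by (simp add: ptrans_nth)
  then show ?thesis by (simp add: inner_mat)
qed

text \<open>\<open>slice X u v\<close> is \<open>(\<langle>u| \<otimes> 1) X (|v\<rangle> \<otimes> 1)\<close>, and \<open>contract Z X\<close> is the partial trace of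
  \<open>(1 \<otimes> Z\<^sup>*) X\<close> over the second tensor factor.\<close>

definition slice :: "(('a::finite \<times> 'c::finite) \<times> ('b::finite \<times> 'd::finite)) op
    \<Rightarrow> complex ^ ('a \<times> 'b) \<Rightarrow> complex ^ ('a \<times> 'b) \<Rightarrow> ('c \<times> 'd) op" where
  "slice X u v = (\<chi> p' q'. \<Sum>p\<in>UNIV. \<Sum>q\<in>UNIV. cnj (u $ p) * X $ idx p p' $ idx q q' * v $ q)"

definition contract :: "('c \<times> 'd) op \<Rightarrow> (('a::finite \<times> 'c::finite) \<times> ('b::finite \<times> 'd::finite)) op
    \<Rightarrow> ('a \<times> 'b) op" where
  "contract Z X = (\<chi> p q. \<Sum>p'\<in>UNIV. \<Sum>q'\<in>UNIV. cnj (Z $ p' $ q') * X $ idx p p' $ idx q q')"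

lemma sum_rotate:
  "(\<Sum>a\<in>A. \<Sum>b\<in>B. \<Sum>c\<in>C. f a b c) = (\<Sum>c\<in>C. \<Sum>a\<in>A. \<Sum>b\<in>B. f a b c)"
proof -
  have "(\<Sum>a\<in>A. \<Sum>b\<in>B. \<Sum>c\<in>C. f a b c) = (\<Sum>a\<in>A. \<Sum>c\<in>C. \<Sum>b\<in>B. f a b c)"
    by (intro sum.cong refl sum.swap)
  also have "\<dots> = (\<Sum>c\<in>C. \<Sum>a\<in>A. \<Sum>b\<in>B. f a b c)" by (rule sum.swap)
  finally show ?thesis .
qed

lemma inner_slice: "x \<bullet> (slice X u v *v y) = tvec u x \<bullet> (X *v tvec v y)"
proof -
  define t where "t p p' q q' = cnj (u $ p) * cnj (x $ p') * X $ idx p p' $ idx q q' * v $ q * y $ q'"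
    for p p' q q'
  have "cinner x (slice X u v *v y) = (\<Sum>p'\<in>UNIV. \<Sum>q'\<in>UNIV. \<Sum>p\<in>UNIV. \<Sum>q\<in>UNIV. t p p' q q')"
    by (simp add: cinner_def matrix_vector_mult_def slice_def t_def sum_distrib_left sum_distrib_right mult_ac)
  also have "\<dots> = (\<Sum>p\<in>UNIV. \<Sum>p'\<in>UNIV. \<Sum>q'\<in>UNIV. \<Sum>q\<in>UNIV. t p p' q q')"
    by (rule sum_rotate)
  also have "\<dots> = (\<Sum>p\<in>UNIV. \<Sum>p'\<in>UNIV. \<Sum>q\<in>UNIV. \<Sum>q'\<in>UNIV. t p p' q q')"
    by (intro sum.cong refl sum.swap)
  also have "\<dots> = cinner (tvec u x) (X *v tvec v y)"
    by (simp add: cinner_def matrix_vector_mult_def t_def sum_idx tvec_idx sum_distrib_left mult_ac)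
  finally show ?thesis by (metis Re_cinner)
qed

text \<open>Matrix elements of a contraction are values of the functional Z on slices, so bounds on
  that functional pass to the contraction.\<close>

lemma inner_contract: "u \<bullet> (contract Z X *v v) = Z \<bullet> slice X u v"
proof -
  define t where "t p p' q q' = cnj (u $ p) * cnj (Z $ p' $ q') * X $ idx p p' $ idx q q' * v $ q"
    for p p' q q'
  have "cinner u (contract Z X *v v) = (\<Sum>p\<in>UNIV. \<Sum>q\<in>UNIV. \<Sum>p'\<in>UNIV. \<Sum>q'\<in>UNIV. t p p' q q')"
    by (simp add: cinner_def matrix_vector_mult_def contract_def t_def sum_distrib_left sum_distrib_right mult_ac)
  also have "\<dots> = (\<Sum>p'\<in>UNIV. \<Sum>p\<in>UNIV. \<Sum>q\<in>UNIV. \<Sum>q'\<in>UNIV. t p p' q q')"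
    by (rule sum_rotate)
  also have "\<dots> = (\<Sum>p'\<in>UNIV. \<Sum>q'\<in>UNIV. \<Sum>p\<in>UNIV. \<Sum>q\<in>UNIV. t p p' q q')"
    by (intro sum.cong refl sum_rotate)
  also have "\<dots> = (\<Sum>p'\<in>UNIV. \<Sum>q'\<in>UNIV. cnj (Z $ p' $ q') * slice X u v $ p' $ q')"
    by (simp add: slice_def t_def sum_distrib_left mult_ac)
  finally have "Re (cinner u (contract Z X *v v)) = Z \<bullet> slice X u v"
    by (simp only: inner_mat)
  then show ?thesis by (simp only: Re_cinner)
qed

lemma opnorm_slice: "opnorm (slice X u v) \<le> opnorm X * (norm u * norm v)"
proof (rule opnorm_leI)
  fix x y
  show "x \<bullet> (slice X u v *v y) \<le> opnorm X * (norm u * norm v) * (norm x * norm y)"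
    using inner_mult_le_opnorm[of "tvec u x" X "tvec v y"]
    by (simp add: inner_slice norm_tvec mult_ac)
qed (simp add: opnorm_nonneg)

lemma hermitian_slice:
  assumes "hermitian X" shows "hermitian (slice X u u)"
  using assms unfolding hermitian_iff[of "slice X u u"]
  by (metis inner_slice inner_commute hermitian_iff)

lemma hermitian_contract:
  assumes "hermitian Z" "hermitian X"
  shows "hermitian (contract Z X)"
  unfolding hermitian_nth
proof (intro allI)
  have Z: "cnj (Z $ a $ b) = Z $ b $ a" and X: "cnj (X $ r $ s) = X $ s $ r" for a b r s
    using assms unfolding hermitian_nth by (blast intro: sym)+
  fix p q
  have "cnj (contract Z X $ p $ q) = (\<Sum>p'\<in>UNIV. \<Sum>q'\<in>UNIV. cnj (Z $ q' $ p') * X $ idx q q' $ idx p p')"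
    by (simp add: contract_def Z X)
  also have "\<dots> = contract Z X $ q $ p"
    by (subst sum.swap) (simp add: contract_def)
  finally show "contract Z X $ q $ p = cnj (contract Z X $ p $ q)" ..
qed

text \<open>Partial transposition on BB' acts on B and B' independently; its B' part only permutes
  the summation indices and can be shifted to Z.\<close>

lemma ptrans_contract: "ptrans (contract Z X) = contract (ptrans Z) (ptrans X)"
proof -
  have "ptrans (contract Z X) $ p $ q = contract (ptrans Z) (ptrans X) $ p $ q" for p q
    using sum_ptrans[of "\<lambda>p' q'. cnj (Z $ p' $ q') * X $ idx (fst p, snd q) p' $ idx (fst q, snd p) q'"]
    by (simp add: contract_def ptrans_nth idx_def)
  then show ?thesis by (simp add: vec_eq_iff)
qed

subsection \<open>Tensor products of positive operators\<close>

lemma quadratic_form_add: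
  assumes "hermitian A"
  shows "(x + y) \<bullet> (A *v (x + y)) = x \<bullet> (A *v x) + 2 * (y \<bullet> (A *v x)) + y \<bullet> (A *v y)"
proof -
  have "x \<bullet> (A *v y) = y \<bullet> (A *v x)"
    using assms by (metis hermitian_iff inner_commute)
  then show ?thesis
    by (simp add: matrix_vector_right_distrib inner_add_left inner_add_right)
qed

lemma psd_diag_pos:
  assumes "psd A" "A $ i \<noteq> 0"
  obtains c where "0 < c" "A $ i $ i = of_real c"
proof -
  have h: "hermitian A" and nonneg: "\<And>x. 0 \<le> x \<bullet> (A *v x)"
    using assms(1) by (auto simp: psd_iff)
  have "A $ i $ i = cnj (A $ i $ i)"
    using h unfolding hermitian_nth by blast
  from arg_cong[OF this, of Im] have real: "A $ i $ i = of_real (Re (A $ i $ i))"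
    by (simp add: complex_eq_iff)
  have "0 \<le> Re (A $ i $ i)"
    using nonneg[of "axis i 1"]
    by (simp add: inner_axis' matrix_vector_mult_axis inner_complex_def)
  moreover have "Re (A $ i $ i) \<noteq> 0"
  proof
    assume "Re (A $ i $ i) = 0"
    then have ii: "A $ i $ i = 0" by (subst real) simp
    obtain j where j: "A $ i $ j \<noteq> 0" using assms(2) by (auto simp: vec_eq_iff)
    \<comment> \<open>This t makes the cross term -(A_jj + 1). As A_ii = 0, the form at
      \<open>axis j 1 + y\<close> is then A_jj - 2(A_jj + 1), which is negative.\<close>
    define t where "t = (Re (A $ j $ j) + 1) / (A $ i $ j \<bullet> A $ i $ j)"
    define y where "y = axis i ((- t) *\<^sub>R A $ i $ j)"
    have "y \<bullet> (A *v axis j 1) = - (t * (A $ i $ j \<bullet> A $ i $ j))"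
      by (simp add: y_def inner_axis' matrix_vector_mult_axis)
    also have "\<dots> = - (Re (A $ j $ j) + 1)"
      using j by (simp add: t_def)
    finally have 1: "y \<bullet> (A *v axis j 1) = - (Re (A $ j $ j) + 1)" .
    have 2: "y \<bullet> (A *v y) = 0"
      by (simp add: y_def inner_axis' matrix_vector_mult_axis ii)
    have 3: "axis j 1 \<bullet> (A *v axis j 1) = Re (A $ j $ j)"
      by (simp add: inner_axis' matrix_vector_mult_axis inner_complex_def)
    have "0 \<le> Re (A $ j $ j)"
      using nonneg[of "axis j 1"] by (simp add: 3)
    then show False
      using nonneg[of "axis j 1 + y"] unfolding quadratic_form_add[OF h] 1 2 3 by simp
  qed
  ultimately have "0 < Re (A $ i $ i)" by simp
  then show ?thesis using real by (rule that)
qed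

definition rank_one :: "complex ^ 'n \<Rightarrow> 'n::finite op" where
  "rank_one v = (\<chi> p q. v $ p * cnj (v $ q))"

lemma rank_one_mult: "rank_one v *v x = cinner v x *s v"
  by (simp add: rank_one_def matrix_vector_mult_def vec_eq_iff cinner_def sum_distrib_left
      sum_distrib_right mult_ac)

lemma inner_rank_one: "x \<bullet> (rank_one v *v x) = (norm (cinner v x))\<^sup>2"
proof -
  have "cinner x (c *s v) = c * cinner x v" for c
    by (simp add: cinner_def sum_distrib_left mult_ac)
  then have "cinner x (rank_one v *v x) = cinner v x * cinner x v"
    by (simp add: rank_one_mult)
  also have "cinner x v = cnj (cinner v x)"
    by (simp add: cinner_def mult.commute)
  finally have "cinner x (rank_one v *v x) = of_real ((norm (cinner v x))\<^sup>2)"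
    by (simp only: complex_norm_square)
  then show ?thesis by (metis Re_cinner Re_complex_of_real)
qed

lemma hermitian_rank_one: "hermitian (rank_one v)"
  by (simp add: hermitian_def adj_def rank_one_def mult.commute)

text \<open>Completing the square: the form of the complement at x is the form of A at a shifted
  vector.\<close>

lemma psd_schur_complement:
  assumes "psd A" and c: "0 < c" "A $ i $ i = of_real c"
  shows "psd (A - (1 / c) *\<^sub>R rank_one (\<chi> p. A $ p $ i))" (is "psd (A - _ *\<^sub>R rank_one ?v)")
proof -
  have h: "hermitian A" and nonneg: "\<And>x. 0 \<le> x \<bullet> (A *v x)"
    using assms(1) by (auto simp: psd_iff)
  have "0 \<le> x \<bullet> ((A - (1 / c) *\<^sub>R rank_one ?v) *v x)" for x
  proof -
    define w where "w = (A *v x) $ i"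
    \<comment> \<open>The shift along coordinate i for which entry i of A(x + y) vanishes, which
      minimises the form in that direction.\<close>
    define y where "y = axis i ((- 1 / c) *\<^sub>R w)"
    have "cinner ?v x = w"
      using h by (auto simp: cinner_def w_def matrix_vector_mult_def hermitian_def adj_def vec_eq_iff intro!: sum.cong)
    then have "x \<bullet> ((A - (1 / c) *\<^sub>R rank_one ?v) *v x) = x \<bullet> (A *v x) - (w \<bullet> w) / c"
      by (simp add: matrix_vector_mult_diff_rdistrib scaleR_matrix_vector_mult inner_diff_right
          inner_rank_one power2_norm_eq_inner)
    also have "\<dots> = x \<bullet> (A *v x) + 2 * (y \<bullet> (A *v x)) + y \<bullet> (A *v y)"
    proof -
      have "y \<bullet> (A *v x) = - ((w \<bullet> w) / c)"
        by (simp add: y_def inner_axis' w_def[symmetric])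
      moreover have "(A *v y) $ i = - w"
        using c by (simp add: y_def matrix_vector_mult_axis scaleR_conv_of_real)
      then have "y \<bullet> (A *v y) = (w \<bullet> w) / c"
        unfolding y_def by (simp add: inner_axis')
      ultimately show ?thesis by simp
    qed
    also have "\<dots> = (x + y) \<bullet> (A *v (x + y))"
      by (simp add: quadratic_form_add[OF h])
    finally show ?thesis using nonneg by simp
  qed
  then show ?thesis
    by (simp add: psd_iff hermitian_diff hermitian_scaleR hermitian_rank_one h)
qed

lemma bitensor_rank_one_nonneg:
  assumes "psd B"
  shows "0 \<le> y \<bullet> (bitensor (rank_one v) B *v y)"
proof -
  \<comment> \<open>The contraction of y with v on the first factor; the form of the tensor product
    at y is the form of B at w.\<close>
  define w where "w = (\<chi> q'. \<Sum>q\<in>UNIV. cnj (v $ q) * y $ idx q q')"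
  have "cinner y (bitensor (rank_one v) B *v y)
      = (\<Sum>p\<in>UNIV. \<Sum>p'\<in>UNIV. \<Sum>q\<in>UNIV. \<Sum>q'\<in>UNIV.
          cnj (y $ idx p p') * v $ p * cnj (v $ q) * B $ p' $ q' * y $ idx q q')"
    by (simp add: cinner_def matrix_vector_mult_def sum_idx bitensor_idx rank_one_def sum_distrib_left mult_ac)
  also have "\<dots> = (\<Sum>p'\<in>UNIV. \<Sum>p\<in>UNIV. \<Sum>q'\<in>UNIV. \<Sum>q\<in>UNIV.
          cnj (y $ idx p p') * v $ p * cnj (v $ q) * B $ p' $ q' * y $ idx q q')"
    by (subst sum.swap) (intro sum.cong refl sum.swap)
  also have "\<dots> = (\<Sum>p'\<in>UNIV. \<Sum>q'\<in>UNIV. \<Sum>q\<in>UNIV. \<Sum>p\<in>UNIV.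
          cnj (y $ idx p p') * v $ p * cnj (v $ q) * B $ p' $ q' * y $ idx q q')"
    by (intro sum.cong refl sum_rotate[symmetric])
  also have "\<dots> = cinner w (B *v w)"
    by (simp add: cinner_def w_def matrix_vector_mult_def sum_distrib_left sum_distrib_right mult_ac)
  finally have "y \<bullet> (bitensor (rank_one v) B *v y) = w \<bullet> (B *v w)"
    by (simp only: Re_cinner[symmetric])
  then show ?thesis using assms by (simp add: psd_iff)
qed

text \<open>Each Schur complement clears at least one nonzero row and splits off a rank-one term,
  which makes a spectral decomposition unnecessary.\<close>

lemma bitensor_nonneg:
  assumes "psd A" "psd B"
  shows "0 \<le> y \<bullet> (bitensor A B *v y)"
  using assms(1)
proof (induction "card {i. A $ i \<noteq> 0}" arbitrary: A rule: less_induct)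
  case less
  show ?case
  proof (cases "A = 0")
    case True
    then have "bitensor A B = 0" by (simp add: vec_eq_idx_iff bitensor_idx)
    then show ?thesis by simp
  next
    case False
    then obtain i where i: "A $ i \<noteq> 0" by (auto simp: vec_eq_iff)
    obtain a where a: "0 < a" "A $ i $ i = of_real a" using psd_diag_pos[OF less.prems i] .
    define c where "c = 1 / a"
    define v where "v = (\<chi> p. A $ p $ i)"
    define A' where "A' = A - c *\<^sub>R rank_one v"
    have h: "A $ p $ q = cnj (A $ q $ p)" for p q
      using less.prems unfolding psd_def hermitian_nth by blast
    have A': "psd A'"
      unfolding A'_def c_def v_def using psd_schur_complement[OF less.prems a] .
    have "A' $ i $ q = 0" for q
    proof -
      have "A' $ i $ q = A $ i $ q - c *\<^sub>R (A $ i $ i * cnj (A $ q $ i))"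
        by (simp add: A'_def rank_one_def v_def)
      also have "cnj (A $ q $ i) = A $ i $ q" by (rule h[symmetric])
      finally show ?thesis
        using a by (simp add: c_def scaleR_conv_of_real)
    qed
    then have "A' $ i = 0" by (simp add: vec_eq_iff)
    \<comment> \<open>Zero rows stay zero because entry p of v belongs to row p of A; so the number
      of nonzero rows strictly drops.\<close>
    moreover have "A' $ p = 0" if "A $ p = 0" for p
    proof -
      have "A' $ p $ q = 0" for q
        using that by (simp add: A'_def rank_one_def v_def)
      then show ?thesis by (simp add: vec_eq_iff)
    qed
    ultimately have "{p. A' $ p \<noteq> 0} \<subset> {p. A $ p \<noteq> 0}" using i by auto
    then have "card {p. A' $ p \<noteq> 0} < card {p. A $ p \<noteq> 0}"
      by (intro psubset_card_mono) auto
    then have "0 \<le> y \<bullet> (bitensor A' B *v y)" using A' by (rule less.hyps)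
    moreover have "0 \<le> c * (y \<bullet> (bitensor (rank_one v) B *v y))"
      using a bitensor_rank_one_nonneg[OF assms(2)]
      by (intro mult_nonneg_nonneg) (simp_all add: c_def)
    moreover have "A = A' + c *\<^sub>R rank_one v" by (simp add: A'_def)
    then have "bitensor A B = bitensor A' B + c *\<^sub>R bitensor (rank_one v) B"
      by (simp only: bitensor_add_left bitensor_scaleR_left)
    then have "y \<bullet> (bitensor A B *v y)
        = y \<bullet> (bitensor A' B *v y) + c * (y \<bullet> (bitensor (rank_one v) B *v y))"
      by (simp only: matrix_vector_mult_add_rdistrib scaleR_matrix_vector_mult inner_add_right
          inner_scaleR_right)
    ultimately show ?thesis by simp
  qed
qed

subsection \<open>The minimisation problem\<close>

definition feasible :: "'n::finite op \<Rightarrow> 'n op \<Rightarrow> bool" where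
  "feasible Q Y \<longleftrightarrow> hermitian Y \<and> (\<forall>x. \<bar>x \<bullet> (Q *v x)\<bar> \<le> x \<bullet> (Y *v x))"

definition eta_min :: "('a::finite \<times> 'b::finite) op \<Rightarrow> real \<Rightarrow> bool" where
  "eta_min Q r \<longleftrightarrow> (\<exists>Y. feasible Q Y \<and> opnorm (ptrans Y) = r) \<and>
     (\<forall>Y. feasible Q Y \<longrightarrow> r \<le> opnorm (ptrans Y))"

lemma eta_feasible_iff: "eta_feasible \<rho> Y \<longleftrightarrow> feasible (ptrans (supp_proj \<rho>)) Y"
proof -
  have "hermitian (ptrans (supp_proj \<rho>))"
    by (intro hermitian_ptrans hermitian_supp_proj)
  then have "hermitian Y \<Longrightarrow> ?thesis"
    unfolding eta_feasible_def feasible_def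
    by (auto simp: loewner_le_iff hermitian_uminus uminus_matrix_vector_mult abs_le_iff minus_le_iff)
  then show ?thesis by (auto simp: eta_feasible_def feasible_def)
qed

text \<open>The negated logarithm turns the least norm into the greatest exponent; positivity of r
  keeps every norm in the range where the logarithm is monotone.\<close>

lemma E_eta_eq:
  assumes "eta_min (ptrans (supp_proj \<rho>)) r" "0 < r"
  shows "E_eta \<rho> = - log 2 r"
  unfolding E_eta_def eta_feasible_iff
  by (rule Greatest_equality) (use assms in \<open>auto simp: eta_min_def intro: log_mono\<close>)

section \<open>Attainment of the minimum\<close>

lemma feasible_nonempty: "feasible Q (opnorm Q *\<^sub>R mat 1)"
proof -
  have "\<bar>x \<bullet> (Q *v x)\<bar> \<le> opnorm Q * (norm x * norm x)" for x
    using inner_mult_le_opnorm[of x Q x] inner_mult_le_opnorm[of "- x" Q x] by (simp add: abs_le_iff)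
  then show ?thesis
    by (simp add: feasible_def hermitian_nth mat_def scaleR_matrix_vector_mult[of _ "mat 1", unfolded mat_def]
      matrix_vector_mul_lid[unfolded mat_def] power2_norm_eq_inner[symmetric] power2_eq_square)
qed

lemma feasible_closed: "closed {Y. feasible Q Y}"
proof -
  have "linear (adj :: 'a op \<Rightarrow> _)"
    by (rule linearI) (simp_all add: adj_def vec_eq_iff)
  then have "closed {Y :: 'a op. adj Y = Y}"
    by (intro closed_Collect_eq linear_continuous_on continuous_on_id) (simp add: linear_linear)
  moreover have "closed {Y. \<bar>x \<bullet> (Q *v x)\<bar> \<le> x \<bullet> (Y *v x)}" for x :: "complex ^ 'a"
  proof -
    have "linear (\<lambda>Y. x \<bullet> (Y *v x))"
      by (rule linearI) (simp_all add: matrix_vector_mult_add_rdistrib scaleR_matrix_vector_mult inner_add_right)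
    then show ?thesis
      by (intro closed_Collect_le continuous_on_const linear_continuous_on) (simp add: linear_linear)
  qed
  moreover have "{Y. feasible Q Y} = {Y. adj Y = Y} \<inter> (\<Inter>x. {Y. \<bar>x \<bullet> (Q *v x)\<bar> \<le> x \<bullet> (Y *v x)})"
    by (auto simp: feasible_def hermitian_def)
  ultimately show ?thesis by auto
qed

lemma continuous_on_opnorm_ptrans: "continuous_on S (\<lambda>Y. opnorm (ptrans Y))"
proof -
  have "continuous_on S ptrans"
    using ptrans_linear by (intro linear_continuous_on) (simp add: linear_linear)
  then show ?thesis
    using continuous_on_compose[OF _ continuous_on_opnorm] by (simp add: o_def)
qed

lemma eta_min_exists:
  fixes Q :: "('a::finite \<times> 'b::finite) op"
  obtains r where "eta_min Q r"
proof -
  define Y0 where "Y0 = opnorm Q *\<^sub>R (mat 1 :: ('a \<times> 'b) op)"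
  \<comment> \<open>Feasible points no worse than the reference point \<open>Y0\<close>: a compact
    set on which the minimum is already the global one.\<close>
  define K where "K = {Y. feasible Q Y} \<inter> {Y. opnorm (ptrans Y) \<le> opnorm (ptrans Y0)}"
  have Y0: "feasible Q Y0" unfolding Y0_def by (rule feasible_nonempty)
  have "closed K" unfolding K_def
    by (intro closed_Int feasible_closed closed_Collect_le continuous_on_opnorm_ptrans continuous_on_const)
  moreover have "bounded K"
    unfolding bounded_iff
  proof (intro exI ballI)
    fix Y assume "Y \<in> K"
    \<comment> \<open>Partial transposition is a self-adjoint involution, hence an isometry for the
      Hilbert-Schmidt norm.\<close>
    have "norm Y = norm (ptrans Y)"
      by (simp add: norm_eq_sqrt_inner inner_ptrans)
    also have "\<dots> \<le> real CARD('a \<times> 'b) * (real CARD('a \<times> 'b) * opnorm (ptrans Y))"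
      by (rule norm_le_opnorm)
    also have "\<dots> \<le> real CARD('a \<times> 'b) * (real CARD('a \<times> 'b) * opnorm (ptrans Y0))"
      using \<open>Y \<in> K\<close> unfolding K_def by (intro mult_left_mono) auto
    finally show "norm Y \<le> real CARD('a \<times> 'b) * (real CARD('a \<times> 'b) * opnorm (ptrans Y0))" .
  qed
  ultimately have "compact K" by (simp add: compact_eq_bounded_closed)
  moreover have "K \<noteq> {}" using Y0 by (auto simp: K_def)
  ultimately obtain Y where "Y \<in> K" "\<And>Y'. Y' \<in> K \<Longrightarrow> opnorm (ptrans Y) \<le> opnorm (ptrans Y')"
    using continuous_attains_inf[OF _ _ continuous_on_opnorm_ptrans] by metis
  then have "eta_min Q (opnorm (ptrans Y))"
    unfolding eta_min_def K_def by (smt (verit) Int_iff mem_Collect_eq)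
  then show ?thesis by (rule that)
qed

lemma eta_min_pos:
  assumes "hermitian Q" "Q \<noteq> 0" "eta_min Q r"
  shows "0 < r"
proof -
  obtain Y where Y: "feasible Q Y" "opnorm (ptrans Y) = r"
    using assms(3) by (auto simp: eta_min_def)
  have "r \<noteq> 0"
  proof
    assume "r = 0"
    then have "ptrans Y = 0" using Y opnorm_eq_0 by blast
    then have "Y = 0" by (metis ptrans_ptrans linear_0 ptrans_linear)
    then have 0: "x \<bullet> (Q *v x) = 0" for x using Y(1) by (simp add: feasible_def)
    \<comment> \<open>Polarization: a Hermitian operator with vanishing quadratic form is
      zero.\<close>
    have "y \<bullet> (Q *v x) = 0" for x y
      using quadratic_form_add[OF assms(1), of x y] by (simp add: 0)
    then have "Q *v x = 0" for x by (metis inner_eq_zero_iff)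
    then show False using assms(2) by (simp add: matrix_eq)
  qed
  then show ?thesis using Y(2) opnorm_nonneg[of "ptrans Y"] by simp
qed

section \<open>The dual witness\<close>

lemma adj_inner: "adj Z \<bullet> X = Z \<bullet> adj X"
proof -
  have "adj Z \<bullet> X = (\<Sum>i\<in>UNIV. \<Sum>j\<in>UNIV. (adj Z $ i $ j) \<bullet> (X $ i $ j))"
    by (simp add: inner_vec_def)
  also have "\<dots> = (\<Sum>j\<in>UNIV. \<Sum>i\<in>UNIV. (adj Z $ i $ j) \<bullet> (X $ i $ j))"
    by (rule sum.swap)
  also have "\<dots> = Z \<bullet> adj X"
    by (simp add: inner_vec_def adj_def inner_complex_def)
  finally show ?thesis .
qed

lemma feasible_convex: "convex {Y. feasible Q Y}"
proof (rule convexI)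
  fix X Y and u v :: real
  assume XY: "X \<in> {Y. feasible Q Y}" "Y \<in> {Y. feasible Q Y}" and uv: "0 \<le> u" "0 \<le> v" "u + v = 1"
  have "\<bar>x \<bullet> (Q *v x)\<bar> \<le> u * (x \<bullet> (X *v x)) + v * (x \<bullet> (Y *v x))" for x
  proof -
    have "\<bar>x \<bullet> (Q *v x)\<bar> = u * \<bar>x \<bullet> (Q *v x)\<bar> + v * \<bar>x \<bullet> (Q *v x)\<bar>"
      using uv by (simp add: distrib_right[symmetric])
    also have "\<dots> \<le> u * (x \<bullet> (X *v x)) + v * (x \<bullet> (Y *v x))"
      using XY uv by (intro add_mono mult_left_mono) (auto simp: feasible_def)
    finally show ?thesis .
  qed
  then show "u *\<^sub>R X + v *\<^sub>R Y \<in> {Y. feasible Q Y}"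
    using XY by (simp add: feasible_def hermitian_add hermitian_scaleR matrix_vector_mult_add_rdistrib
        scaleR_matrix_vector_mult inner_add_right)
qed

text \<open>Hahn--Banach: the open operator-norm ball of radius \<open>r\<close> misses the image of the feasible
  set under partial transposition.\<close>

lemma eta_min_dual:
  fixes Q :: "('a::finite \<times> 'b::finite) op"
  assumes min: "eta_min Q r" and r: "0 < r"
  obtains Z where "hermitian Z" "\<And>X. Z \<bullet> X \<le> opnorm X" "\<And>Y. feasible Q Y \<Longrightarrow> r \<le> Z \<bullet> ptrans Y"
proof -
  let ?A = "{X :: ('a \<times> 'b) op. opnorm X < r}" and ?B = "ptrans ` {Y. feasible Q Y}"
  have "convex ?A"
  proof (rule convexI)
    fix X Y :: "('a \<times> 'b) op" and u v :: real
    assume *: "X \<in> ?A" "Y \<in> ?A" "0 \<le> u" "0 \<le> v" "u + v = 1"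
    have "opnorm (u *\<^sub>R X + v *\<^sub>R Y) \<le> u * opnorm X + v * opnorm Y"
      using opnorm_add[of "u *\<^sub>R X" "v *\<^sub>R Y"] * by (simp add: opnorm_scaleR)
    also have "\<dots> < r" using * by (intro convex_bound_lt) auto
    finally show "u *\<^sub>R X + v *\<^sub>R Y \<in> ?A" by simp
  qed
  moreover have "convex ?B"
    by (rule convex_linear_image[OF ptrans_linear feasible_convex])
  moreover have zero: "0 \<in> ?A" using opnorm_scaleR[of 0 "0 :: ('a \<times> 'b) op"] r by simp
  moreover have "?B \<noteq> {}" using feasible_nonempty by blast
  moreover have "?A \<inter> ?B = {}" using min by (auto simp: eta_min_def not_less[symmetric])
  ultimately obtain a b where a: "a \<noteq> 0" and A: "\<And>X. opnorm X < r \<Longrightarrow> a \<bullet> X \<le> b"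
    and B: "\<And>Y. feasible Q Y \<Longrightarrow> b \<le> a \<bullet> ptrans Y"
    using separating_hyperplane_sets[of ?A ?B] by blast
  have b0: "0 \<le> b" using A[of 0] zero by simp
  \<comment> \<open>X is rescaled to norm s r with s < 1, which lies in the open ball; letting s
    tend to 1 gives the homogeneous inequality.\<close>
  have bound: "r * (a \<bullet> X) \<le> b * opnorm X" for X
  proof (cases "X = 0")
    case True
    then show ?thesis using b0 by (simp add: opnorm_nonneg)
  next
    case False
    then have X: "0 < opnorm X" using opnorm_eq_0[of X] opnorm_nonneg[of X] by fastforce
    show ?thesis
    proof (rule field_le_mult_one_interval)
      fix s :: real assume s: "0 < s" "s < 1"
      have "opnorm ((s * r / opnorm X) *\<^sub>R X) = s * r"
        using X s r by (simp add: opnorm_scaleR)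
      also have "\<dots> < r" using s r by simp
      finally have "(s * r / opnorm X) * (a \<bullet> X) \<le> b" using A by fastforce
      then show "s * (r * (a \<bullet> X)) \<le> b * opnorm X" using X by (simp add: field_simps)
    qed
  qed
  \<comment> \<open>With X = a the bound would fail for b = 0, so b can be scaled to r.\<close>
  have "0 < r * (a \<bullet> a)" using a r by simp
  then have b: "0 < b" using bound[of a] b0 by (cases "b = 0") auto
  define W where "W = (r / b) *\<^sub>R a"
  have W1: "W \<bullet> X \<le> opnorm X" for X
    using bound[of X] b by (simp add: W_def field_simps)
  have W2: "r \<le> W \<bullet> ptrans Y" if "feasible Q Y" for Y
    using mult_left_mono[OF B[OF that], of "r / b"] b r by (simp add: W_def)
  \<comment> \<open>The Hermitian part of the functional keeps both bounds: the adjoint does not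
    increase the operator norm, and \<open>ptrans Y\<close> is self-adjoint for feasible Y.\<close>
  define Z where "Z = (1 / 2) *\<^sub>R (W + adj W)"
  have Z: "Z \<bullet> X = (W \<bullet> X + W \<bullet> adj X) / 2" for X
    by (simp add: Z_def inner_add_left adj_inner)
  show ?thesis
  proof
    show "hermitian Z" by (simp add: hermitian_def adj_def Z_def vec_eq_iff)
    show "Z \<bullet> X \<le> opnorm X" for X
      using W1[of X] W1[of "adj X"] opnorm_adj[of X] by (simp add: Z)
    show "r \<le> Z \<bullet> ptrans Y" if "feasible Q Y" for Y
    proof -
      have "adj (ptrans Y) = ptrans Y"
        using that hermitian_ptrans[of Y] by (simp add: feasible_def hermitian_def)
      then show ?thesis using W2[OF that] by (simp add: Z)
    qed
  qed
qed

text \<open>The case \<open>c = 0\<close> says that the witness is nonnegative on positive operators; it is a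
  recession-cone argument.\<close>

lemma dual_homogeneous:
  assumes Z: "\<And>Y. feasible Q Y \<Longrightarrow> r \<le> Z \<bullet> ptrans Y" and r: "0 < r"
    and W: "hermitian W" "\<And>x. \<bar>c * (x \<bullet> (Q *v x))\<bar> \<le> x \<bullet> (W *v x)"
  shows "\<bar>c\<bar> * r \<le> Z \<bullet> ptrans W"
proof (cases "c = 0")
  case False
  have "\<bar>x \<bullet> (Q *v x)\<bar> \<le> (x \<bullet> (W *v x)) / \<bar>c\<bar>" for x
    using W(2)[of x] False by (simp add: abs_mult field_simps)
  then have "feasible Q ((1 / \<bar>c\<bar>) *\<^sub>R W)"
    using W by (simp add: feasible_def hermitian_scaleR scaleR_matrix_vector_mult)
  from Z[OF this] have "r \<le> (Z \<bullet> ptrans W) / \<bar>c\<bar>"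
    by (simp add: linear_scale[OF ptrans_linear])
  then show ?thesis using False by (simp add: field_simps)
next
  case True
  obtain Y where Y: "feasible Q Y" using feasible_nonempty by blast
  have lin: "r \<le> Z \<bullet> ptrans Y + t * (Z \<bullet> ptrans W)" if "0 \<le> t" for t
  proof -
    have "0 \<le> t * (x \<bullet> (W *v x))" for x
      using W(2)[of x] that True by simp
    then have "feasible Q (Y + t *\<^sub>R W)"
      using Y W(1) unfolding feasible_def
      by (simp add: hermitian_add hermitian_scaleR matrix_vector_mult_add_rdistrib
          scaleR_matrix_vector_mult inner_add_right add_increasing2)
    from Z[OF this] show ?thesis
      by (simp add: linear_add[OF ptrans_linear] linear_scale[OF ptrans_linear] inner_add_right)
  qed
  have "\<not> Z \<bullet> ptrans W < 0"
  proof
    assume neg: "Z \<bullet> ptrans W < 0"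
    have "0 \<le> Z \<bullet> ptrans Y" using Z[OF Y] r by simp
    \<comment> \<open>At this t the right-hand side of \<open>lin\<close> is zero, contradicting r >
      0.\<close>
    then have "0 \<le> Z \<bullet> ptrans Y / - (Z \<bullet> ptrans W)" using neg by (intro divide_nonneg_nonneg) auto
    from lin[OF this] show False using neg r by (simp add: field_simps)
  qed
  then show ?thesis using True by simp
qed

section \<open>Multiplicativity of the minimum\<close>

lemma feasible_psd:
  assumes "hermitian Q" "feasible Q Y"
  shows "psd (Y - Q)" "psd (Y + Q)"
proof -
  have "\<bar>x \<bullet> (Q *v x)\<bar> \<le> x \<bullet> (Y *v x)" for x
    using assms(2) by (simp add: feasible_def)
  then have "x \<bullet> (Q *v x) \<le> x \<bullet> (Y *v x)" "0 \<le> x \<bullet> (Y *v x) + x \<bullet> (Q *v x)" for x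
    by (smt (verit))+
  then show "psd (Y - Q)" "psd (Y + Q)"
    using assms by (simp_all add: feasible_def psd_iff hermitian_add hermitian_diff inner_add_right
        inner_diff_right matrix_vector_mult_add_rdistrib matrix_vector_mult_diff_rdistrib)
qed

lemma feasible_bitensor:
  assumes Q: "hermitian Q1" "hermitian Q2" and Y: "feasible Q1 Y1" "feasible Q2 Y2"
  shows "feasible (bitensor Q1 Q2) (bitensor Y1 Y2)"
proof -
  note psd = feasible_psd[OF Q(1) Y(1)] feasible_psd[OF Q(2) Y(2)]
  have "\<bar>x \<bullet> (bitensor Q1 Q2 *v x)\<bar> \<le> x \<bullet> (bitensor Y1 Y2 *v x)" for x
  proof -
    have "2 *\<^sub>R (bitensor Y1 Y2 - bitensor Q1 Q2)
        = bitensor (Y1 - Q1) (Y2 + Q2) + bitensor (Y1 + Q1) (Y2 - Q2)"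
      by (simp add: bitensor_add_left bitensor_add_right bitensor_diff_left bitensor_diff_right scaleR_2)
    then have "2 * (x \<bullet> ((bitensor Y1 Y2 - bitensor Q1 Q2) *v x))
        = x \<bullet> (bitensor (Y1 - Q1) (Y2 + Q2) *v x) + x \<bullet> (bitensor (Y1 + Q1) (Y2 - Q2) *v x)"
      unfolding inner_scaleR_right[symmetric] scaleR_matrix_vector_mult[symmetric]
        inner_add_right[symmetric] matrix_vector_mult_add_rdistrib[symmetric]
      by simp
    moreover have "2 *\<^sub>R (bitensor Y1 Y2 + bitensor Q1 Q2)
        = bitensor (Y1 - Q1) (Y2 - Q2) + bitensor (Y1 + Q1) (Y2 + Q2)"
      by (simp add: bitensor_add_left bitensor_add_right bitensor_diff_left bitensor_diff_right scaleR_2)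
    then have "2 * (x \<bullet> ((bitensor Y1 Y2 + bitensor Q1 Q2) *v x))
        = x \<bullet> (bitensor (Y1 - Q1) (Y2 - Q2) *v x) + x \<bullet> (bitensor (Y1 + Q1) (Y2 + Q2) *v x)"
      unfolding inner_scaleR_right[symmetric] scaleR_matrix_vector_mult[symmetric]
        inner_add_right[symmetric] matrix_vector_mult_add_rdistrib[symmetric]
      by simp
    ultimately show ?thesis
      using bitensor_nonneg[OF psd(1,4), of x] bitensor_nonneg[OF psd(2,3), of x]
        bitensor_nonneg[OF psd(1,3), of x] bitensor_nonneg[OF psd(2,4), of x]
      by (simp add: matrix_vector_mult_add_rdistrib matrix_vector_mult_diff_rdistrib
          inner_add_right inner_diff_right abs_le_iff)
  qed
  then show ?thesis using Y by (simp add: feasible_def hermitian_bitensor)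
qed

lemma opnorm_contract:
  assumes "\<And>X. Z \<bullet> X \<le> opnorm X"
  shows "opnorm (contract Z X) \<le> opnorm X"
proof (rule opnorm_leI[OF opnorm_nonneg])
  show "u \<bullet> (contract Z X *v v) \<le> opnorm X * (norm u * norm v)" for u v
    unfolding inner_contract by (rule order_trans[OF assms opnorm_slice])
qed

lemma eta_min_bitensor:
  assumes Q: "hermitian Q1" "hermitian Q2"
    and min: "eta_min Q1 r1" "eta_min Q2 r2" and r: "0 < r1" "0 < r2"
  shows "eta_min (bitensor Q1 Q2) (r1 * r2)"
proof -
  have lower: "r1 * r2 \<le> opnorm (ptrans Y)" if Y: "feasible (bitensor Q1 Q2) Y" for Y
  proof -
    obtain Z where Z: "hermitian Z" "\<And>X. Z \<bullet> X \<le> opnorm X"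
      "\<And>Y. feasible Q2 Y \<Longrightarrow> r2 \<le> Z \<bullet> ptrans Y"
      using eta_min_dual[OF min(2) r(2)] by metis
    \<comment> \<open>Contracting with \<open>ptrans Z\<close> evaluates Z on partially transposed
      slices, where the witness inequality applies. After partial transposition it becomes
      contraction with Z itself, where the dual unit ball bound applies.\<close>
    define Y1 where "Y1 = (1 / r2) *\<^sub>R contract (ptrans Z) Y"
    have hY: "hermitian Y" using Y by (simp add: feasible_def)
    have "\<bar>u \<bullet> (Q1 *v u)\<bar> \<le> u \<bullet> (Y1 *v u)" for u
    proof -
      \<comment> \<open>Feasibility at product vectors: for fixed u the slice dominates both signs
        of c Q2, where c is the form of Q1 at u.\<close>
      have "\<bar>(u \<bullet> (Q1 *v u)) * (x \<bullet> (Q2 *v x))\<bar> \<le> x \<bullet> (slice Y u u *v x)" for x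
        using Y unfolding feasible_def by (metis inner_slice inner_bitensor_tvec[OF Q(1)])
      then have "\<bar>u \<bullet> (Q1 *v u)\<bar> * r2 \<le> Z \<bullet> ptrans (slice Y u u)"
        using dual_homogeneous[of Q2 r2 Z "slice Y u u" "u \<bullet> (Q1 *v u)"] Z(3) r(2) hermitian_slice[OF hY]
        by blast
      also have "\<dots> = u \<bullet> (contract (ptrans Z) Y *v u)"
        by (simp add: inner_contract inner_ptrans)
      finally show ?thesis
        using r by (simp add: Y1_def scaleR_matrix_vector_mult field_simps)
    qed
    then have "feasible Q1 Y1"
      using hermitian_contract[OF hermitian_ptrans[OF Z(1)] hY]
      by (simp add: feasible_def Y1_def hermitian_scaleR)
    then have "r1 \<le> opnorm (ptrans Y1)" using min(1) by (simp add: eta_min_def)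
    also have "ptrans Y1 = (1 / r2) *\<^sub>R contract Z (ptrans Y)"
      by (simp add: Y1_def linear_scale[OF ptrans_linear] ptrans_contract)
    also have "opnorm \<dots> = opnorm (contract Z (ptrans Y)) / r2"
      using r by (simp add: opnorm_scaleR)
    also have "\<dots> \<le> opnorm (ptrans Y) / r2"
      using r by (intro divide_right_mono opnorm_contract Z(2)) simp
    finally show ?thesis using r by (simp add: field_simps)
  qed
  obtain Y1 Y2 where Y: "feasible Q1 Y1" "feasible Q2 Y2"
    and o: "opnorm (ptrans Y1) = r1" "opnorm (ptrans Y2) = r2"
    using min by (auto simp: eta_min_def)
  have f: "feasible (bitensor Q1 Q2) (bitensor Y1 Y2)"
    by (rule feasible_bitensor[OF Q Y])
  have "opnorm (ptrans (bitensor Y1 Y2)) \<le> r1 * r2"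
    using opnorm_bitensor_le[of "ptrans Y1" "ptrans Y2"] by (simp add: ptrans_bitensor o)
  with lower[OF f] have "opnorm (ptrans (bitensor Y1 Y2)) = r1 * r2" by simp
  then show ?thesis using f lower unfolding eta_min_def by blast
qed

text \<open>Trace one excludes the zero operator, so the support projection and its partial
  transpose are nonzero and the minimum is positive.\<close>

lemma state_eta_min:
  assumes "state \<rho>"
  obtains r where "eta_min (ptrans (supp_proj \<rho>)) r" "0 < r"
proof -
  obtain r where r: "eta_min (ptrans (supp_proj \<rho>)) r" by (rule eta_min_exists)
  have "\<rho> \<noteq> 0" using assms by (auto simp: state_def trace_def)
  then obtain x where "\<rho> *v x \<noteq> 0" by (auto simp: matrix_eq)
  then have "supp_proj \<rho> *v x \<noteq> 0" by (simp add: supp_proj_eq_0_iff)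
  then have "supp_proj \<rho> \<noteq> 0" by auto
  then have "ptrans (supp_proj \<rho>) \<noteq> 0" by (metis ptrans_ptrans linear_0 ptrans_linear)
  then have "0 < r"
    using eta_min_pos[OF hermitian_ptrans[OF hermitian_supp_proj] _ r] by blast
  with r show ?thesis by (rule that)
qed

theorem proposition4:
  fixes \<rho>\<^sub>1 :: "('a::finite \<times> 'b::finite) op"
    and \<rho>\<^sub>2 :: "('c::finite \<times> 'd::finite) op"
  assumes "state \<rho>\<^sub>1" and "state \<rho>\<^sub>2"
  shows "E_eta (bitensor \<rho>\<^sub>1 \<rho>\<^sub>2) = E_eta \<rho>\<^sub>1 + E_eta \<rho>\<^sub>2"
proof -
  obtain r1 where r1: "eta_min (ptrans (supp_proj \<rho>\<^sub>1)) r1" "0 < r1"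
    using state_eta_min[OF assms(1)] .
  obtain r2 where r2: "eta_min (ptrans (supp_proj \<rho>\<^sub>2)) r2" "0 < r2"
    using state_eta_min[OF assms(2)] .
  have "eta_min (ptrans (supp_proj (bitensor \<rho>\<^sub>1 \<rho>\<^sub>2))) (r1 * r2)"
    unfolding supp_proj_bitensor ptrans_bitensor
    by (intro eta_min_bitensor hermitian_ptrans hermitian_supp_proj r1 r2)
  then have "E_eta (bitensor \<rho>\<^sub>1 \<rho>\<^sub>2) = - log 2 (r1 * r2)"
    by (rule E_eta_eq) (simp add: r1 r2)
  then show ?thesis
    using E_eta_eq[OF r1] E_eta_eq[OF r2] r1(2) r2(2) by (simp add: log_mult)
qed

end
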